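(* Let $\mathbf{x}_0\in\mathbb{R}^n$, $r>0$, let $\mathcal{X}_k\subset\mathbb{R}^n$ be a finite interpolation set, let $f:\mathbb{R}^n\to\mathbb{R}$, let $Q_{k-1}\in\mathcal{Q}$, and let $Q_k$ be the solution of the problem $$\min_{Q\in\mathcal{Q}}\ \|Q-Q_{k-1}\|_{H^2(\mathcal{B}_2^r(\mathbf{x}_0))}^2\quad\text{subject to}\quad Q(\mathbf{x})=f(\mathbf{x}),\ \mathbf{x}\in\mathcal{X}_k.$$ If $f$ is quadratic, then $$\|Q_k-f\|_{H^2(\mathcal{B}_2^r(\mathbf{x}_0))}^2=\|Q_{k-1}-f\|_{H^2(\mathcal{B}_2^r(\mathbf{x}_0))}^2-\|Q_k-Q_{k-1}\|_{H^2(\mathcal{B}_2^r(\mathbf{x}_0))}^2.$$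
   Context: $\mathcal{Q}$ is the set of quadratic functions on $\mathbb{R}^n$, where "quadratic function" means a real polynomial of degree at most 2. $\mathcal{B}_2^{r}(\mathbf{x}_0)=\{\mathbf{x}\in\mathbb{R}^n:\|\mathbf{x}-\mathbf{x}_0\|_2\le r\}$. $\|u\|_{H^2(\Omega)}^2=\int_\Omega |u(\mathbf{x})|^2d\mathbf{x}+\int_\Omega\|\nabla u(\mathbf{x})\|_2^2d\mathbf{x}+\int_\Omega\|\nabla^2u(\mathbf{x})\|_F^2d\mathbf{x}$, with $\|\cdot\|_F$ the Frobenius norm. *)

theory Defs
  imports "HOL-Analysis.Analysis"
begin

text \<open>
  Real polynomials of degree at most 2 in the coordinates of \<open>x\<close>. The coefficient
  matrix \<open>A\<close> is not required to be symmetric, so \<open>A\<close> is not determined by the function.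
\<close>

definition quadratic_functions :: "(real ^ 'n \<Rightarrow> real) set" where
  "quadratic_functions =
     {Q. \<exists>(c::real) (b::real ^ 'n) (A::real ^ 'n ^ 'n).
           \<forall>x. Q x = c + (\<Sum>i\<in>UNIV. b $ i * x $ i)
                       + (\<Sum>i\<in>UNIV. \<Sum>j\<in>UNIV. A $ i $ j * x $ i * x $ j)}"

definition gradient :: "(real ^ 'n \<Rightarrow> real) \<Rightarrow> real ^ 'n \<Rightarrow> real ^ 'n" where
  "gradient u x = (THE D. GDERIV u x :> D)"

definition hessian :: "(real ^ 'n \<Rightarrow> real) \<Rightarrow> real ^ 'n \<Rightarrow> real ^ 'n ^ 'n" where
  "hessian u x = jacobian (gradient u) (at x)"

definition frobenius_norm :: "real ^ 'n ^ 'm \<Rightarrow> real" where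
  "frobenius_norm A = sqrt (\<Sum>i\<in>UNIV. \<Sum>j\<in>UNIV. (A $ i $ j)\<^sup>2)"

text \<open>
  The derivatives are the classical ones, taken in the whole space. The value is therefore
  only meaningful for functions that are twice differentiable everywhere and whose three
  integrals exist, such as polynomials on a bounded measurable set; there the classical
  and the weak derivatives agree.
\<close>

definition H2_norm :: "(real ^ 'n) set \<Rightarrow> (real ^ 'n \<Rightarrow> real) \<Rightarrow> real" where
  "H2_norm \<Omega> u =
     sqrt ((LINT x:\<Omega>|lebesgue. \<bar>u x\<bar>\<^sup>2)
         + (LINT x:\<Omega>|lebesgue. (norm (gradient u x))\<^sup>2)
         + (LINT x:\<Omega>|lebesgue. (frobenius_norm (hessian u x))\<^sup>2))"

end

theory Submission
  imports Defs
begin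

text \<open>
  On quadratic functions the squared \<open>H\<^sup>2\<close> norm over a ball is a quadratic form: all three
  integrals converge there, and \<open>u\<close>, its gradient and its Hessian depend linearly on \<open>u\<close>
  (\<open>H2_norm_square_linear_combination\<close>). The theorem is then Pythagoras' theorem for the
  orthogonal projection of \<open>Q\<^sub>k\<^sub>-\<^sub>1\<close> onto the affine space of quadratic interpolants of \<open>f\<close>.
  Since \<open>f\<close> is itself such an interpolant, the whole line \<open>Q\<^sub>k + t (Q\<^sub>k - f)\<close> is admissible, and
  the squared distance to \<open>Q\<^sub>k\<^sub>-\<^sub>1\<close> along it is a quadratic polynomial in \<open>t\<close> that is minimal at
  \<open>t = 0\<close>. Its linear coefficient, twice the inner product of \<open>Q\<^sub>k - Q\<^sub>k\<^sub>-\<^sub>1\<close> and \<open>Q\<^sub>k - f\<close>,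
  therefore vanishes (\<open>linear_coeff_zero_if_minimal_at_0\<close>), and the value at \<open>t = -1\<close>, which
  belongs to the interpolant \<open>f\<close>, is the claimed identity.
\<close>

section \<open>Derivatives of quadratic functions\<close>

lemma quadratic_functions_iff_inner:
  fixes Q :: "real ^ 'n \<Rightarrow> real"
  shows "Q \<in> quadratic_functions \<longleftrightarrow> (\<exists>c b A. \<forall>x. Q x = c + b \<bullet> x + (x v* A) \<bullet> x)"
proof -
  have quad: "(\<Sum>i\<in>UNIV. \<Sum>j\<in>UNIV. A $ i $ j * x $ i * x $ j) = (x v* A) \<bullet> x"
    for x :: "real ^ 'n" and A :: "real ^ 'n ^ 'n"
    unfolding inner_vec_def vector_matrix_mult_def
    by (subst sum.swap) (simp add: sum_distrib_left mult_ac)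
  have "(\<Sum>i\<in>UNIV. b $ i * x $ i) = b \<bullet> x" for b x :: "real ^ 'n"
    by (simp add: inner_vec_def)
  then show ?thesis
    by (simp only: quadratic_functions_def mem_Collect_eq quad)
qed

lemma quadratic_functions_linear_combination:
  assumes "u \<in> quadratic_functions" "v \<in> quadratic_functions"
  shows "(\<lambda>x. s * u x + t * v x) \<in> quadratic_functions"
proof -
  obtain c b A c' b' A' where
    u: "\<And>x. u x = c + (\<Sum>i\<in>UNIV. b $ i * x $ i)
            + (\<Sum>i\<in>UNIV. \<Sum>j\<in>UNIV. A $ i $ j * x $ i * x $ j)" and
    v: "\<And>x. v x = c' + (\<Sum>i\<in>UNIV. b' $ i * x $ i)
            + (\<Sum>i\<in>UNIV. \<Sum>j\<in>UNIV. A' $ i $ j * x $ i * x $ j)"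
    using assms unfolding quadratic_functions_def by blast
  show ?thesis
    unfolding quadratic_functions_def mem_Collect_eq
    by (rule exI[of _ "s * c + t * c'"], rule exI[of _ "s *\<^sub>R b + t *\<^sub>R b'"],
        rule exI[of _ "s *\<^sub>R A + t *\<^sub>R A'"])
       (simp add: u v algebra_simps sum.distrib sum_distrib_left)
qed

lemma gradient_eqI:
  assumes "GDERIV u x :> D"
  shows "gradient u x = D"
  unfolding gradient_def
proof (rule the_equality)
  show "GDERIV u x :> D" by fact
  fix D' assume "GDERIV u x :> D'"
  then have "(\<lambda>h. h \<bullet> D') = (\<lambda>h. h \<bullet> D)"
    using assms unfolding gderiv_def by (rule has_derivative_unique)
  then show "D' = D"
    by (simp add: fun_eq_iff vector_eq_ldot)
qed

lemma hessian_eqI: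
  assumes "(gradient u has_derivative (*v) M) (at x)"
  shows "hessian u x = M"
  by (simp add: hessian_def jacobian_def frechet_derivative_at[OF assms, symmetric])

lemma quadratic_functions_GDERIV:
  assumes "u \<in> quadratic_functions"
  obtains b M where "\<And>x. GDERIV u x :> b + M *v x"
proof -
  obtain c b A where u: "\<And>x. u x = c + b \<bullet> x + (x v* A) \<bullet> x"
    using assms quadratic_functions_iff_inner by blast
  have lin: "bounded_linear (\<lambda>x. x v* A)"
    unfolding transpose_matrix_vector[symmetric] by (rule matrix_vector_mul_bounded_linear)
  have "GDERIV u x :> b + (A + transpose A) *v x" for x
  proof -
    have "(u has_derivative (\<lambda>h. b \<bullet> h + ((x v* A) \<bullet> h + (h v* A) \<bullet> x))) (at x)"
      unfolding u[abs_def]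
      by (auto intro!: derivative_eq_intros bounded_linear.has_derivative[OF lin])
    moreover have "(h v* A) \<bullet> x = h \<bullet> (A *v x)" for h
      by (rule dot_lmul_matrix)
    ultimately show ?thesis
      by (simp add: gderiv_def inner_add_right matrix_vector_mult_add_rdistrib
          inner_commute add_ac)
  qed
  then show thesis by (rule that)
qed

lemma quadratic_functions_gradient:
  assumes "u \<in> quadratic_functions"
  obtains b M where "\<And>x. gradient u x = b + M *v x" "\<And>x. hessian u x = M"
proof -
  obtain b M where "\<And>x. GDERIV u x :> b + M *v x"
    using quadratic_functions_GDERIV[OF assms] by blast
  then have g: "gradient u = (\<lambda>x. b + M *v x)"
    by (simp add: gradient_eqI fun_eq_iff)
  have "(gradient u has_derivative (*v) M) (at x)" for x
    unfolding g
    by (auto intro!: derivative_eq_intros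
        bounded_linear_imp_has_derivative[OF matrix_vector_mul_bounded_linear])
  then have "hessian u x = M" for x
    by (rule hessian_eqI)
  then show thesis using g that by auto
qed

lemma quadratic_functions_continuous:
  assumes "u \<in> quadratic_functions"
  shows "continuous_on S u" "continuous_on S (gradient u)" "continuous_on S (hessian u)"
proof -
  show "continuous_on S u"
  proof -
    obtain b M where "\<And>x. GDERIV u x :> b + M *v x"
      using quadratic_functions_GDERIV[OF assms] by blast
    then show ?thesis
      unfolding gderiv_def
      by (intro continuous_at_imp_continuous_on ballI) (rule has_derivative_continuous)
  qed
  obtain b M where "\<And>x. gradient u x = b + M *v x" and H: "\<And>x. hessian u x = M"
    using quadratic_functions_gradient[OF assms] by blast
  then have "gradient u = (\<lambda>x. b + M *v x)" by blast
  then show "continuous_on S (gradient u)"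
    by (simp add: continuous_on_add linear_continuous_on matrix_vector_mul_bounded_linear)
  have "hessian u = (\<lambda>x. M)" using H by blast
  then show "continuous_on S (hessian u)" by simp
qed

text \<open>
  Linearity of the gradient and the Hessian needs differentiability, because for a function
  that is not differentiable they are unspecified values. Quadratic functions have a gradient
  everywhere, and it is affine, hence differentiable in turn.
\<close>

lemma gradient_linear_combination:
  assumes "u \<in> quadratic_functions" "v \<in> quadratic_functions"
  shows "gradient (\<lambda>x. s * u x + t * v x) x = s *\<^sub>R gradient u x + t *\<^sub>R gradient v x"
proof -
  have "GDERIV w x :> gradient w x" if w: "w \<in> quadratic_functions" for w
  proof -
    obtain b M where "GDERIV w x :> b + M *v x"
      using quadratic_functions_GDERIV[OF w] by blast
    then show ?thesis by (simp add: gradient_eqI)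
  qed
  then have "GDERIV u x :> gradient u x" "GDERIV v x :> gradient v x"
    using assms by auto
  then show ?thesis
    by (intro gradient_eqI)
       (auto simp: gderiv_def inner_add_right intro!: derivative_eq_intros)
qed

lemma hessian_linear_combination:
  assumes "u \<in> quadratic_functions" "v \<in> quadratic_functions"
  shows "hessian (\<lambda>x. s * u x + t * v x) x = s *\<^sub>R hessian u x + t *\<^sub>R hessian v x"
proof -
  obtain b M where u: "\<And>x. gradient u x = b + M *v x" "\<And>x. hessian u x = M"
    using quadratic_functions_gradient[OF assms(1)] by blast
  obtain b' M' where v: "\<And>x. gradient v x = b' + M' *v x" "\<And>x. hessian v x = M'"
    using quadratic_functions_gradient[OF assms(2)] by blast
  have g: "gradient (\<lambda>x. s * u x + t * v x) = (\<lambda>x. s *\<^sub>R (b + M *v x) + t *\<^sub>R (b' + M' *v x))"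
    by (simp add: fun_eq_iff gradient_linear_combination[OF assms] u v)
  have "(gradient (\<lambda>x. s * u x + t * v x) has_derivative (*v) (s *\<^sub>R M + t *\<^sub>R M')) (at x)"
    unfolding g
    by (auto intro!: derivative_eq_intros
        bounded_linear_imp_has_derivative[OF matrix_vector_mul_bounded_linear]
        simp: matrix_vector_mult_add_rdistrib scaleR_matrix_vector_assoc)
  then show ?thesis
    unfolding u v by (rule hessian_eqI)
qed

section \<open>The squared norm as a quadratic form\<close>

lemma frobenius_norm_eq_norm: "frobenius_norm A = norm A"
  by (simp add: frobenius_norm_def norm_vec_def L2_set_def sum_nonneg)

lemma H2_norm_square:
  "(H2_norm \<Omega> u)\<^sup>2 = (LINT x:\<Omega>|lebesgue. (norm (u x))\<^sup>2)
     + (LINT x:\<Omega>|lebesgue. (norm (gradient u x))\<^sup>2)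
     + (LINT x:\<Omega>|lebesgue. (norm (hessian u x))\<^sup>2)"
  unfolding H2_norm_def frobenius_norm_eq_norm real_norm_def
  by (intro real_sqrt_pow2 add_nonneg_nonneg)
     (auto simp: set_lebesgue_integral_def intro!: integral_nonneg_AE)

lemma set_integrable_lebesgue_compact:
  fixes f :: "'a::euclidean_space \<Rightarrow> real"
  assumes "compact S" "continuous_on S f"
  shows "set_integrable lebesgue S f"
proof -
  have "integrable lborel (\<lambda>x. indicator S x *\<^sub>R f x)"
    using borel_integrable_compact[OF assms] by (simp add: indicator_scaleR_eq_if)
  then show ?thesis
    unfolding set_integrable_def
    by (subst integrable_completion) (auto dest: borel_measurable_integrable)
qed

lemma integral_norm_square_linear_combination:
  fixes F G :: "'a::euclidean_space \<Rightarrow> 'b::real_inner"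
  assumes "compact S" "continuous_on S F" "continuous_on S G"
  shows "(LINT x:S|lebesgue. (norm (s *\<^sub>R F x + t *\<^sub>R G x))\<^sup>2)
    = s\<^sup>2 * (LINT x:S|lebesgue. (norm (F x))\<^sup>2)
      + 2 * s * t * (LINT x:S|lebesgue. F x \<bullet> G x)
      + t\<^sup>2 * (LINT x:S|lebesgue. (norm (G x))\<^sup>2)"
proof -
  have "(norm (s *\<^sub>R F x + t *\<^sub>R G x))\<^sup>2
      = s\<^sup>2 * (norm (F x))\<^sup>2 + 2 * s * t * (F x \<bullet> G x) + t\<^sup>2 * (norm (G x))\<^sup>2" for x
    unfolding power2_norm_eq_inner
    by (simp add: inner_simps inner_commute[of "G x" "F x"] power2_eq_square algebra_simps
        flip: dot_square_norm)
  moreover have "set_integrable lebesgue S (\<lambda>x. (norm (F x))\<^sup>2)"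
    "set_integrable lebesgue S (\<lambda>x. F x \<bullet> G x)" "set_integrable lebesgue S (\<lambda>x. (norm (G x))\<^sup>2)"
    using assms by (auto intro!: set_integrable_lebesgue_compact continuous_intros)
  ultimately show ?thesis
    by (simp add: set_integral_add)
qed

text \<open>
  The witness \<open>\<beta>\<close> is the \<open>H\<^sup>2\<close> inner product of \<open>u\<close> and \<open>v\<close>. Compactness of \<open>S\<close> makes the
  integrals of the continuous integrands converge, which expanding the squares requires.
\<close>

lemma H2_norm_square_linear_combination:
  assumes "compact S" "u \<in> quadratic_functions" "v \<in> quadratic_functions"
  obtains \<beta> where "\<And>s t. (H2_norm S (\<lambda>x. s * u x + t * v x))\<^sup>2
    = s\<^sup>2 * (H2_norm S u)\<^sup>2 + 2 * s * t * \<beta> + t\<^sup>2 * (H2_norm S v)\<^sup>2"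
proof -
  note cont = quadratic_functions_continuous[where S = S]
  note expand = integral_norm_square_linear_combination[OF assms(1)]
  have "(H2_norm S (\<lambda>x. s * u x + t * v x))\<^sup>2
    = s\<^sup>2 * (H2_norm S u)\<^sup>2
      + 2 * s * t * ((LINT x:S|lebesgue. u x \<bullet> v x)
          + (LINT x:S|lebesgue. gradient u x \<bullet> gradient v x)
          + (LINT x:S|lebesgue. hessian u x \<bullet> hessian v x))
      + t\<^sup>2 * (H2_norm S v)\<^sup>2" for s t
    unfolding H2_norm_square gradient_linear_combination[OF assms(2,3)]
      hessian_linear_combination[OF assms(2,3)]
      expand[OF cont(1)[OF assms(2)] cont(1)[OF assms(3)], unfolded real_scaleR_def]
      expand[OF cont(2)[OF assms(2)] cont(2)[OF assms(3)]]
      expand[OF cont(3)[OF assms(2)] cont(3)[OF assms(3)]]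
    by (simp add: algebra_simps)
  then show thesis by (rule that)
qed

section \<open>Minimality and orthogonality\<close>

lemma linear_coeff_zero_if_minimal_at_0:
  fixes \<beta> c :: real
  assumes min: "\<And>t. 0 \<le> 2 * t * \<beta> + t\<^sup>2 * c" and "c \<ge> 0"
  shows "\<beta> = 0"
proof (rule ccontr)
  assume "\<beta> \<noteq> 0"
  \<comment> \<open>The vertex is at \<open>- \<beta> / c\<close>; the shifted denominator also covers \<open>c = 0\<close>.\<close>
  define t where "t = - \<beta> / (c + 1)"
  have "\<beta> = - (t * (c + 1))"
    using \<open>c \<ge> 0\<close> by (simp add: t_def)
  then have "2 * t * \<beta> + t\<^sup>2 * c = - (t\<^sup>2 * (c + 2))"
    by (elim ssubst) (simp add: algebra_simps power2_eq_square)
  moreover have "t\<^sup>2 * (c + 2) > 0"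
    using \<open>\<beta> \<noteq> 0\<close> \<open>c \<ge> 0\<close> by (simp add: t_def)
  ultimately show False
    using min[of t] by simp
qed

theorem theorem3p3:
  fixes x0 :: "real ^ 'n" and r :: real and X :: "(real ^ 'n) set"
    and f Qprev Qk :: "real ^ 'n \<Rightarrow> real"
  assumes "r > 0"
    and "finite X"
    and "Qprev \<in> quadratic_functions"
    and "is_arg_min (\<lambda>Q. (H2_norm (cball x0 r) (\<lambda>x. Q x - Qprev x))\<^sup>2)
           (\<lambda>Q. Q \<in> quadratic_functions \<and> (\<forall>x\<in>X. Q x = f x)) Qk"
    and "f \<in> quadratic_functions"
  shows "(H2_norm (cball x0 r) (\<lambda>x. Qk x - f x))\<^sup>2 =
           (H2_norm (cball x0 r) (\<lambda>x. Qprev x - f x))\<^sup>2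
         - (H2_norm (cball x0 r) (\<lambda>x. Qk x - Qprev x))\<^sup>2"
proof -
  let ?N = "\<lambda>u. (H2_norm (cball x0 r) u)\<^sup>2"
  define u where "u = (\<lambda>x. Qk x - Qprev x)"
  define v where "v = (\<lambda>x. Qk x - f x)"
  have Qk: "Qk \<in> quadratic_functions" and interp: "\<And>x. x \<in> X \<Longrightarrow> Qk x = f x"
    and min: "\<And>Q. Q \<in> quadratic_functions \<Longrightarrow> (\<And>x. x \<in> X \<Longrightarrow> Q x = f x) \<Longrightarrow>
      ?N u \<le> ?N (\<lambda>x. Q x - Qprev x)"
    using assms(4) unfolding is_arg_min_def u_def by (auto simp: not_less)
  have u: "u \<in> quadratic_functions" and v: "v \<in> quadratic_functions"
    using quadratic_functions_linear_combination[OF Qk assms(3), of 1 "-1"]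
      quadratic_functions_linear_combination[OF Qk assms(5), of 1 "-1"]
    by (simp_all add: u_def v_def)
  obtain \<beta> where N: "\<And>s t. ?N (\<lambda>x. s * u x + t * v x) = s\<^sup>2 * ?N u + 2 * s * t * \<beta> + t\<^sup>2 * ?N v"
    using H2_norm_square_linear_combination[OF compact_cball u v] by blast
  have "0 \<le> 2 * t * \<beta> + t\<^sup>2 * ?N v" for t
  proof -
    have "(\<lambda>x. Qk x + t * v x) \<in> quadratic_functions"
      using quadratic_functions_linear_combination[OF Qk v, of 1 t] by simp
    then have "?N u \<le> ?N (\<lambda>x. (Qk x + t * v x) - Qprev x)"
      by (rule min) (simp add: v_def interp)
    also have "(\<lambda>x. (Qk x + t * v x) - Qprev x) = (\<lambda>x. 1 * u x + t * v x)"
      by (simp add: u_def fun_eq_iff)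
    finally show ?thesis
      unfolding N by simp
  qed
  then have "\<beta> = 0"
    by (rule linear_coeff_zero_if_minimal_at_0) simp
  have "(\<lambda>x. Qprev x - f x) = (\<lambda>x. (-1) * u x + 1 * v x)"
    by (simp add: u_def v_def fun_eq_iff)
  then have "?N (\<lambda>x. Qprev x - f x) = ?N u + ?N v"
    by (simp only: N \<open>\<beta> = 0\<close>) simp
  then show ?thesis
    by (simp add: u_def v_def)
qed

end
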